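(* Let $\Gamma$ be a finite set of linear arithmetic atoms over the rationals (equalities $0=t$, weak inequalities $0\le t$ and strict inequalities $0<t$, with $t$ linear terms) that is unsatisfiable over $\mathbb Q$, and let $S=\{0<t_1,\dots,0<t_n\}$ be the strict inequalities of $\Gamma$. Let $\varepsilon$ be a fresh symbol, $S_\varepsilon = \{\varepsilon\le t_1,\dots,\varepsilon\le t_n\}$ and $\Gamma_\varepsilon = (\Gamma\cup S_\varepsilon)\setminus S$. Let $\Gamma$ be partitioned into $A$ and $B$, and let $A_\varepsilon$, $B_\varepsilon$ be obtained from $A$ and $B$ by replacing each atom of $S$ by the corresponding atom of $S_\varepsilon$. Let $I_\varepsilon$ be an interpolant for $(A_\varepsilon,B_\varepsilon)$ computed by the proof-based method from an $\mathcal{LA}(\mathbb Q)$-proof of unsatisfiability of $A_\varepsilon\wedge B_\varepsilon$ in which $\varepsilon$ is treated symbolically as a positive infinitesimal. Then: (1) if $\varepsilon$ does not occur in $I_\varepsilon$, then $I_\varepsilon$ is an interpolant for $(A,B)$; (2) if $\varepsilon$ occurs in $I_\varepsilon$, then $I_\varepsilon$ is of the form $(0\le t - c\,\varepsilon)$ for some linear term $t$ not containing $\varepsilon$ and some rational $c>0$, and $I = (0<t)$ is an interpolant for $(A,B)$.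
   Context: An interpolant for a pair $(A,B)$ of formulas with $A\wedge B$ unsatisfiable is a formula $I$ such that $A\models I$, $I\wedge B$ is unsatisfiable, and every variable (non-interpreted symbol) of $I$ occurs both in $A$ and in $B$. An $\mathcal{LA}(\mathbb Q)$-proof is a derivation tree whose leaves are atoms of the input, built with the rules: from $0=t$ derive $0\le t$ (and $0\le -t$); from $0\le t_1$ and $0\le t_2$ derive $0\le c_1t_1+c_2t_2$ for rational $c_1,c_2>0$. Here the proof for $A_\varepsilon\wedge B_\varepsilon$ derives an atom $0\le c - d\varepsilon$ with rational $c\le 0\le d$ not both zero (unsatisfiable for every $\varepsilon>0$). The proof-based interpolation method replaces every leaf atom $0\le t$ (resp. $0=t$) belonging to $B_\varepsilon$ by $0\le 0$ (resp. $0=0$), propagates the derivation with the same coefficients, and returns the single weak inequality at the root. *)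

theory Defs
  imports Main "HOL.Rat" "HOL-Library.Poly_Mapping" "HOL-Library.Product_Plus"
begin

section \<open>Linear terms over the rationals\<close>

text \<open>
  A linear term is kept in normal form: a constant together with finitely many nonzero
  coefficients. So a variable occurs in a term iff its coefficient is nonzero, and occurrence
  refers to the term after summands have been collected. Addition, difference, negation and
  zero are the library's componentwise operations on pairs.
\<close>

type_synonym 'v lterm = "rat \<times> ('v \<Rightarrow>\<^sub>0 rat)"

definition lconst :: "rat \<Rightarrow> 'v lterm" where
  "lconst q = (q, 0)"

definition lvar :: "'v \<Rightarrow> 'v lterm" where
  "lvar x = (0, Poly_Mapping.single x 1)"

definition lscale :: "rat \<Rightarrow> 'v lterm \<Rightarrow> 'v lterm" where
  "lscale q t = (q * fst t, Poly_Mapping.map ((*) q) (snd t))"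

definition lvars :: "'v lterm \<Rightarrow> 'v set" where
  "lvars t = Poly_Mapping.keys (snd t)"

definition leval :: "('v \<Rightarrow> rat) \<Rightarrow> 'v lterm \<Rightarrow> rat" where
  "leval \<sigma> t = fst t + (\<Sum>x\<in>Poly_Mapping.keys (snd t). Poly_Mapping.lookup (snd t) x * \<sigma> x)"


section \<open>Atoms, satisfiability and interpolants\<close>

text \<open>\<open>Eq0 t\<close>, \<open>Le0 t\<close> and \<open>Lt0 t\<close> stand for $0 = t$, $0 \le t$ and $0 < t$.\<close>

datatype 'v latom = Eq0 "'v lterm" | Le0 "'v lterm" | Lt0 "'v lterm"

fun atom_vars :: "'v latom \<Rightarrow> 'v set" where
  "atom_vars (Eq0 t) = lvars t"
| "atom_vars (Le0 t) = lvars t"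
| "atom_vars (Lt0 t) = lvars t"

fun sat_atom :: "('v \<Rightarrow> rat) \<Rightarrow> 'v latom \<Rightarrow> bool" where
  "sat_atom \<sigma> (Eq0 t) \<longleftrightarrow> 0 = leval \<sigma> t"
| "sat_atom \<sigma> (Le0 t) \<longleftrightarrow> 0 \<le> leval \<sigma> t"
| "sat_atom \<sigma> (Lt0 t) \<longleftrightarrow> 0 < leval \<sigma> t"

text \<open>A set of atoms is read as the conjunction of its members.\<close>

definition vars_of :: "'v latom set \<Rightarrow> 'v set" where
  "vars_of G = (\<Union>a\<in>G. atom_vars a)"

definition unsat :: "'v latom set \<Rightarrow> bool" where
  "unsat G \<longleftrightarrow> \<not> (\<exists>\<sigma>. \<forall>a\<in>G. sat_atom \<sigma> a)"

definition entails :: "'v latom set \<Rightarrow> 'v latom \<Rightarrow> bool" where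
  "entails G b \<longleftrightarrow> (\<forall>\<sigma>. (\<forall>a\<in>G. sat_atom \<sigma> a) \<longrightarrow> sat_atom \<sigma> b)"

definition interpolant :: "'v latom set \<Rightarrow> 'v latom set \<Rightarrow> 'v latom \<Rightarrow> bool" where
  "interpolant A B I \<longleftrightarrow>
     unsat (A \<union> B) \<and> entails A I \<and> unsat (insert I B) \<and>
     atom_vars I \<subseteq> vars_of A \<inter> vars_of B"


section \<open>Replacing strict inequalities\<close>

text \<open>$\varepsilon \le t$ is written as $0 \le t - \varepsilon$.\<close>

fun eps_atom :: "'v \<Rightarrow> 'v latom \<Rightarrow> 'v latom" where
  "eps_atom \<epsilon> (Lt0 t) = Le0 (t - lvar \<epsilon>)"
| "eps_atom \<epsilon> (Eq0 t) = Eq0 t"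
| "eps_atom \<epsilon> (Le0 t) = Le0 t"

definition eps_set :: "'v \<Rightarrow> 'v latom set \<Rightarrow> 'v latom set" where
  "eps_set \<epsilon> G = eps_atom \<epsilon> ` G"

lemma eps_set_alt:
  fixes G :: "'v latom set" and \<epsilon> :: 'v
  defines "S \<equiv> {a \<in> G. \<exists>t. a = Lt0 t}"
    and "S\<epsilon> \<equiv> {Le0 (t - lvar \<epsilon>) | t. Lt0 t \<in> G}"
  shows "eps_set \<epsilon> G = (G \<union> S\<epsilon>) - S"
proof
  show "eps_set \<epsilon> G \<subseteq> (G \<union> S\<epsilon>) - S"
  proof
    fix b assume "b \<in> eps_set \<epsilon> G"
    then obtain a where "a \<in> G" "b = eps_atom \<epsilon> a" by (auto simp: eps_set_def)
    then show "b \<in> (G \<union> S\<epsilon>) - S" by (cases a) (auto simp: S_def S\<epsilon>_def)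
  qed
  show "(G \<union> S\<epsilon>) - S \<subseteq> eps_set \<epsilon> G"
  proof
    fix b assume "b \<in> (G \<union> S\<epsilon>) - S"
    then have "(b \<in> G \<and> eps_atom \<epsilon> b = b) \<or> (\<exists>t. Lt0 t \<in> G \<and> b = eps_atom \<epsilon> (Lt0 t))"
      by (cases b) (auto simp: S_def S\<epsilon>_def)
    then show "b \<in> eps_set \<epsilon> G"
      unfolding eps_set_def by (metis image_eqI)
  qed
qed


section \<open>Proofs and proof-based interpolation\<close>

text \<open>
  A proof tree records its leaves, the rule applied at each inner node and the rational
  coefficients, but not the derived atoms; those are computed by \<open>derives\<close>. The same tree can
  thus be replayed on other leaves.
\<close>

datatype 'a la_proof =
    Leaf 'a
  | EqPos "'a la_proof"
  | EqNeg "'a la_proof"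
  | Comb rat "'a la_proof" rat "'a la_proof"

inductive derives :: "'v latom la_proof \<Rightarrow> 'v latom \<Rightarrow> bool" where
  leaf: "derives (Leaf a) a"
| eq_pos: "derives P (Eq0 t) \<Longrightarrow> derives (EqPos P) (Le0 t)"
| eq_neg: "derives P (Eq0 t) \<Longrightarrow> derives (EqNeg P) (Le0 (- t))"
| comb: "\<lbrakk>derives P\<^sub>1 (Le0 t\<^sub>1); derives P\<^sub>2 (Le0 t\<^sub>2); c\<^sub>1 > 0; c\<^sub>2 > 0\<rbrakk>
    \<Longrightarrow> derives (Comb c\<^sub>1 P\<^sub>1 c\<^sub>2 P\<^sub>2) (Le0 (lscale c\<^sub>1 t\<^sub>1 + lscale c\<^sub>2 t\<^sub>2))"

text \<open>
  The root is unsatisfiable for every $\varepsilon > 0$; this is how $\varepsilon$ is treated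
  as a positive infinitesimal, although no atom $0 < \varepsilon$ is among the leaves.
\<close>

definition eps_refutation :: "'v \<Rightarrow> 'v latom set \<Rightarrow> 'v latom la_proof \<Rightarrow> bool" where
  "eps_refutation \<epsilon> G P \<longleftrightarrow>
     set_la_proof P \<subseteq> G \<and>
     (\<exists>c d. c \<le> 0 \<and> 0 \<le> d \<and> \<not> (c = 0 \<and> d = 0) \<and>
            derives P (Le0 (lconst c - lscale d (lvar \<epsilon>))))"

text \<open>The \<open>Lt0\<close> equation only makes the function total: leaves are never strict.\<close>

fun zero_atom :: "'v latom \<Rightarrow> 'v latom" where
  "zero_atom (Eq0 t) = Eq0 0"
| "zero_atom (Le0 t) = Le0 0"
| "zero_atom (Lt0 t) = Lt0 0"

definition proof_interpolant :: "'v latom set \<Rightarrow> 'v latom la_proof \<Rightarrow> 'v latom \<Rightarrow> bool" where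
  "proof_interpolant B P I \<longleftrightarrow>
     derives (map_la_proof (\<lambda>a. if a \<in> B then zero_atom a else a) P) I"

end

theory Submission
  imports Defs
begin

text \<open>
  Split the root $c - d\varepsilon$ of the refutation as $t_A + t_B$, where $t_A$ is the term of
  the computed interpolant and $t_B$ collects the contribution of the leaves from $B_\varepsilon$.
  Since $\varepsilon$ enters only through strict atoms, with coefficient $-1$, both sides have the
  form $s - e\varepsilon$ with $e \ge 0$, where $0 \le s$ follows from the respective side and even
  $0 < s$ does if $e > 0$. As $s_A + s_B = c \le 0$ and $e_A + e_B = d$, a model of both
  $B$ and the interpolant would force $c = 0$ and $e_A = e_B = 0 = d$. Variables of
  $s_A$ cancel in the sum, so they also occur in $s_B$.
\<close>

section \<open>Linear terms: coefficients and evaluation\<close>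

lemma lookup_snd_lscale [simp]:
  "Poly_Mapping.lookup (snd (lscale q t)) x = q * Poly_Mapping.lookup (snd t) x"
  by (simp add: lscale_def map.rep_eq when_def)

lemma fst_lscale [simp]: "fst (lscale q t) = q * fst t"
  by (simp add: lscale_def)

lemma fst_lvar [simp]: "fst (lvar x) = 0"
  by (simp add: lvar_def)

lemma lookup_snd_lvar [simp]:
  "Poly_Mapping.lookup (snd (lvar x)) y = (if x = y then 1 else 0)"
  by (simp add: lvar_def lookup_single when_def)

lemma lterm_eqI:
  assumes "fst t = fst u"
    and "\<And>x. Poly_Mapping.lookup (snd t) x = Poly_Mapping.lookup (snd u) x"
  shows "t = u"
  using assms by (auto intro!: prod_eqI poly_mapping_eqI)

lemma in_lvars_iff: "x \<in> lvars t \<longleftrightarrow> Poly_Mapping.lookup (snd t) x \<noteq> 0"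
  by (simp add: lvars_def in_keys_iff)

text \<open>Coefficients outside the support are zero. Terms with different supports can thus be
  summed over one common index set, where evaluation is visibly linear.\<close>

lemma leval_superset:
  assumes "finite X" "lvars t \<subseteq> X"
  shows "leval \<sigma> t = fst t + (\<Sum>x\<in>X. Poly_Mapping.lookup (snd t) x * \<sigma> x)"
  unfolding leval_def
  using assms by (auto simp: lvars_def in_keys_iff intro!: sum.mono_neutral_left)

lemma finite_lvars [simp]: "finite (lvars t)"
  by (simp add: lvars_def)

lemma leval_zero [simp]: "leval \<sigma> 0 = 0"
  by (simp add: leval_def)

lemma leval_lconst [simp]: "leval \<sigma> (lconst q) = q"
  by (simp add: leval_def lconst_def)

lemma leval_add [simp]: "leval \<sigma> (t + u) = leval \<sigma> t + leval \<sigma> u"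
proof -
  have "lvars (t + u) \<subseteq> lvars t \<union> lvars u"
    by (auto simp: in_lvars_iff lookup_add)
  then show ?thesis
    by (simp add: leval_superset[of "lvars t \<union> lvars u"] lookup_add
        sum.distrib distrib_right)
qed

lemma leval_lscale [simp]: "leval \<sigma> (lscale q t) = q * leval \<sigma> t"
proof -
  have "lvars (lscale q t) \<subseteq> lvars t"
    by (auto simp: in_lvars_iff)
  then show ?thesis
    by (simp add: leval_superset[of "lvars t"] sum_distrib_left distrib_left mult.assoc)
qed

lemma leval_uminus [simp]: "leval \<sigma> (- t) = - leval \<sigma> t"
proof -
  have "leval \<sigma> (t + - t) = leval \<sigma> t + leval \<sigma> (- t)"
    by (rule leval_add)
  then show ?thesis by simp
qed

section \<open>Consequences with the contribution of \<epsilon> separated\<close>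

lemma atom_vars_subset_vars_of: "a \<in> G \<Longrightarrow> atom_vars a \<subseteq> vars_of G"
  by (auto simp: vars_of_def)

text \<open>The pair \<open>s\<close>, \<open>e\<close> stands for
  \<open>s - e * \<epsilon>\<close>, with \<open>e\<close> the accumulated weight of strict atoms.
  The models are those of the original \<open>G\<close>, before \<epsilon> is introduced: a positive
  weight is turned back into strictness.\<close>

definition eps_bound :: "'v latom set \<Rightarrow> 'v lterm \<Rightarrow> rat \<Rightarrow> bool" where
  "eps_bound G s e \<longleftrightarrow> 0 \<le> e \<and> lvars s \<subseteq> vars_of G \<and>
     (\<forall>\<sigma>. (\<forall>a\<in>G. sat_atom \<sigma> a) \<longrightarrow> 0 \<le> leval \<sigma> s \<and> (0 < e \<longrightarrow> 0 < leval \<sigma> s))"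

definition eps_consequence :: "'v \<Rightarrow> 'v latom set \<Rightarrow> 'v lterm \<Rightarrow> bool" where
  "eps_consequence \<epsilon> G t \<longleftrightarrow> (\<exists>s e. t = s - lscale e (lvar \<epsilon>) \<and> eps_bound G s e)"

lemma eps_consequenceI:
  assumes "t = s - lscale e (lvar \<epsilon>)" "eps_bound G s e"
  shows "eps_consequence \<epsilon> G t"
  using assms unfolding eps_consequence_def by blast

lemma eps_consequence_zero [simp]: "eps_consequence \<epsilon> G 0"
  by (rule eps_consequenceI[of _ 0 0])
    (auto simp: eps_bound_def in_lvars_iff lookup_minus intro!: lterm_eqI)

text \<open>Terms and weights combine with the same coefficients, and a positive combination of
  nonnegative values is positive as soon as one of them is.\<close>

lemma eps_consequence_comb:
  assumes "eps_consequence \<epsilon> G t" "eps_consequence \<epsilon> G u" "0 < p" "0 < q"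
  shows "eps_consequence \<epsilon> G (lscale p t + lscale q u)"
proof -
  obtain s e where s: "t = s - lscale e (lvar \<epsilon>)" "eps_bound G s e"
    using assms(1) by (auto simp: eps_consequence_def)
  obtain r f where r: "u = r - lscale f (lvar \<epsilon>)" "eps_bound G r f"
    using assms(2) by (auto simp: eps_consequence_def)
  have "lscale p t + lscale q u =
      (lscale p s + lscale q r) - lscale (p * e + q * f) (lvar \<epsilon>)"
    by (rule lterm_eqI) (simp_all add: s r lookup_add lookup_minus algebra_simps)
  moreover have "eps_bound G (lscale p s + lscale q r) (p * e + q * f)"
    unfolding eps_bound_def
  proof (intro conjI allI impI)
    show "0 \<le> p * e + q * f"
      using s(2) r(2) assms(3,4) by (simp add: eps_bound_def)
    have "lvars (lscale p s + lscale q r) \<subseteq> lvars s \<union> lvars r"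
      by (auto simp: in_lvars_iff lookup_add)
    then show "lvars (lscale p s + lscale q r) \<subseteq> vars_of G"
      using s(2) r(2) by (auto simp: eps_bound_def)
  next
    fix \<sigma> assume "\<forall>a\<in>G. sat_atom \<sigma> a"
    then have *: "0 \<le> leval \<sigma> s" "0 < e \<longrightarrow> 0 < leval \<sigma> s" "0 \<le> e"
        "0 \<le> leval \<sigma> r" "0 < f \<longrightarrow> 0 < leval \<sigma> r" "0 \<le> f"
      using s(2) r(2) by (auto simp: eps_bound_def)
    then show "0 \<le> leval \<sigma> (lscale p s + lscale q r)"
      using assms(3,4) by simp
    assume "0 < p * e + q * f"
    \<comment> \<open>Both weights are nonnegative; were both zero, the combined weight would
      vanish.\<close>
    then have "0 < e \<or> 0 < f"
      using *(3,6) by (auto simp: less_le)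
    then show "0 < leval \<sigma> (lscale p s + lscale q r)"
      using *(1,2,4,5) assms(3,4)
      by (auto intro: add_pos_nonneg add_nonneg_pos mult_pos_pos mult_nonneg_nonneg)
  qed
  ultimately show ?thesis by (rule eps_consequenceI)
qed

text \<open>An equality carries both signs, so that \<open>EqPos\<close> and \<open>EqNeg\<close>
  can each take one.\<close>

fun eps_entails :: "'v \<Rightarrow> 'v latom set \<Rightarrow> 'v latom \<Rightarrow> bool" where
  "eps_entails \<epsilon> G (Le0 t) \<longleftrightarrow> eps_consequence \<epsilon> G t"
| "eps_entails \<epsilon> G (Eq0 t) \<longleftrightarrow> eps_consequence \<epsilon> G t \<and> eps_consequence \<epsilon> G (- t)"
| "eps_entails \<epsilon> G (Lt0 t) \<longleftrightarrow> False"

text \<open>Equalities and weak inequalities get weight 0; a strict atom gets weight 1, the amount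
  of \<epsilon> subtracted from it.\<close>

lemma eps_entails_eps_atom:
  assumes "a \<in> G"
  shows "eps_entails \<epsilon> G (eps_atom \<epsilon> a)"
proof (cases a)
  case (Eq0 t)
  have *: "u = u - lscale 0 (lvar \<epsilon>)" for u :: "'a lterm"
    by (rule lterm_eqI) (simp_all add: lookup_minus)
  have "lvars t \<subseteq> vars_of G" "lvars (- t) \<subseteq> vars_of G"
    using atom_vars_subset_vars_of[OF assms] Eq0 by (auto simp: in_lvars_iff)
  moreover have "leval \<sigma> t = 0" if "\<forall>a\<in>G. sat_atom \<sigma> a" for \<sigma>
    using that assms Eq0 by force
  ultimately have "eps_bound G t 0" "eps_bound G (- t) 0"
    by (auto simp: eps_bound_def)
  then show ?thesis
    unfolding Eq0 by (simp add: eps_consequenceI[OF *])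
next
  case (Le0 t)
  have "eps_bound G t 0"
    using atom_vars_subset_vars_of[OF assms] assms Le0 by (fastforce simp: eps_bound_def)
  moreover have "t = t - lscale 0 (lvar \<epsilon>)"
    by (rule lterm_eqI) (simp_all add: lookup_minus)
  ultimately show ?thesis
    unfolding Le0 by (simp only: eps_atom.simps eps_entails.simps eps_consequenceI)
next
  case (Lt0 t)
  have "eps_bound G t 1"
    using atom_vars_subset_vars_of[OF assms] assms Lt0 by (fastforce simp: eps_bound_def)
  moreover have "t - lvar \<epsilon> = t - lscale 1 (lvar \<epsilon>)"
    by (rule lterm_eqI) (simp_all add: lookup_minus)
  ultimately show ?thesis
    unfolding Lt0 by (simp only: eps_atom.simps eps_entails.simps eps_consequenceI)
qed

section \<open>Splitting a derivation into shares of \<open>A\<close> and \<open>B\<close>\<close>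

fun split_atom :: "'v \<Rightarrow> 'v latom set \<Rightarrow> 'v latom set \<Rightarrow> 'v latom \<Rightarrow> 'v latom \<Rightarrow> bool" where
  "split_atom \<epsilon> A B (Le0 t) (Le0 u) \<longleftrightarrow> eps_entails \<epsilon> A (Le0 u) \<and> eps_entails \<epsilon> B (Le0 (t - u))"
| "split_atom \<epsilon> A B (Eq0 t) (Eq0 u) \<longleftrightarrow> eps_entails \<epsilon> A (Eq0 u) \<and> eps_entails \<epsilon> B (Eq0 (t - u))"
| "split_atom \<epsilon> A B _ _ \<longleftrightarrow> False"

inductive_cases derives_LeafE: "derives (Leaf a) b"
inductive_cases derives_EqPosE: "derives (EqPos P) b"
inductive_cases derives_EqNegE: "derives (EqNeg P) b"
inductive_cases derives_CombE: "derives (Comb c P d Q) b"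

text \<open>Each leaf belongs wholly to one side, the other share being 0. A leaf lying in both sets
  is charged to \<open>B\<close>, as in the replay.\<close>

lemma split_atom_leaf:
  assumes "a \<in> eps_set \<epsilon> A \<union> eps_set \<epsilon> B"
  shows "split_atom \<epsilon> A B a (if a \<in> eps_set \<epsilon> B then zero_atom a else a)"
proof (cases "a \<in> eps_set \<epsilon> B")
  case True
  then have "eps_entails \<epsilon> B a"
    by (auto simp: eps_set_def intro: eps_entails_eps_atom)
  with True show ?thesis by (cases a) auto
next
  case False
  with assms have "eps_entails \<epsilon> A a"
    by (auto simp: eps_set_def intro: eps_entails_eps_atom)
  with False show ?thesis by (cases a) auto
qed

text \<open>The replay computes the share of \<open>A\<close>. Every rule is linear, so what it
  omits, \<open>t - u\<close>, is derived by the same rules and coefficients from the leaves of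
  \<open>B\<close>.\<close>

lemma split_atom_replay:
  assumes "derives P a"
    and "derives (map_la_proof (\<lambda>a. if a \<in> eps_set \<epsilon> B then zero_atom a else a) P) b"
    and "set_la_proof P \<subseteq> eps_set \<epsilon> A \<union> eps_set \<epsilon> B"
  shows "split_atom \<epsilon> A B a b"
  using assms
proof (induction arbitrary: b rule: derives.induct)
  case (leaf a)
  have "b = (if a \<in> eps_set \<epsilon> B then zero_atom a else a)"
    using leaf.prems(1) by (auto elim!: derives_LeafE)
  moreover have "a \<in> eps_set \<epsilon> A \<union> eps_set \<epsilon> B"
    using leaf.prems(2) by simp
  ultimately show ?case
    using split_atom_leaf by (simp only:)
next
  case (eq_pos P t)
  from eq_pos.prems(1) obtain u where u: "b = Le0 u"
    "derives (map_la_proof (\<lambda>a. if a \<in> eps_set \<epsilon> B then zero_atom a else a) P) (Eq0 u)"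
    by (auto elim: derives_EqPosE)
  have "split_atom \<epsilon> A B (Eq0 t) (Eq0 u)"
    using eq_pos.IH[OF u(2)] eq_pos.prems(2) by simp
  then show ?case
    using u(1) by simp
next
  case (eq_neg P t)
  from eq_neg.prems(1) obtain u where u: "b = Le0 (- u)"
    "derives (map_la_proof (\<lambda>a. if a \<in> eps_set \<epsilon> B then zero_atom a else a) P) (Eq0 u)"
    by (auto elim: derives_EqNegE)
  have "split_atom \<epsilon> A B (Eq0 t) (Eq0 u)"
    using eq_neg.IH[OF u(2)] eq_neg.prems(2) by simp
  moreover have "- (t - u) = - t - - u" by simp
  ultimately show ?case
    using u(1) by simp
next
  case (comb P\<^sub>1 t\<^sub>1 P\<^sub>2 t\<^sub>2 c\<^sub>1 c\<^sub>2)
  from comb.prems(1) obtain u\<^sub>1 u\<^sub>2 where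
    b: "b = Le0 (lscale c\<^sub>1 u\<^sub>1 + lscale c\<^sub>2 u\<^sub>2)" and
    u: "derives (map_la_proof (\<lambda>a. if a \<in> eps_set \<epsilon> B then zero_atom a else a) P\<^sub>1) (Le0 u\<^sub>1)"
      "derives (map_la_proof (\<lambda>a. if a \<in> eps_set \<epsilon> B then zero_atom a else a) P\<^sub>2) (Le0 u\<^sub>2)"
    by (auto elim: derives_CombE)
  have "split_atom \<epsilon> A B (Le0 t\<^sub>1) (Le0 u\<^sub>1)" "split_atom \<epsilon> A B (Le0 t\<^sub>2) (Le0 u\<^sub>2)"
    using comb.IH(1)[OF u(1)] comb.IH(2)[OF u(2)] comb.prems(2) by auto
  \<comment> \<open>The share of \<open>B\<close> in a combination is the combination of its shares,
    so \<open>eps_consequence_comb\<close> serves both sides.\<close>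
  moreover have "lscale c\<^sub>1 t\<^sub>1 + lscale c\<^sub>2 t\<^sub>2 - (lscale c\<^sub>1 u\<^sub>1 + lscale c\<^sub>2 u\<^sub>2) =
      lscale c\<^sub>1 (t\<^sub>1 - u\<^sub>1) + lscale c\<^sub>2 (t\<^sub>2 - u\<^sub>2)"
    by (rule lterm_eqI) (simp_all add: lookup_add lookup_minus algebra_simps)
  ultimately show ?case
    using b comb.hyps by (simp add: eps_consequence_comb)
qed

section \<open>Reading the interpolant off the split root\<close>

theorem mainTheorem3:
  fixes \<Gamma> A B :: "'v latom set" and \<epsilon> :: 'v
    and P :: "'v latom la_proof" and I\<epsilon> :: "'v latom"
  assumes "finite \<Gamma>"
    and "unsat \<Gamma>"
    and "\<epsilon> \<notin> vars_of \<Gamma>"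
    and "\<Gamma> = A \<union> B" and "A \<inter> B = {}"
    and "eps_refutation \<epsilon> (eps_set \<epsilon> A \<union> eps_set \<epsilon> B) P"
    and "proof_interpolant (eps_set \<epsilon> B) P I\<epsilon>"
  shows "(\<epsilon> \<notin> atom_vars I\<epsilon> \<longrightarrow> interpolant A B I\<epsilon>) \<and>
    (\<epsilon> \<in> atom_vars I\<epsilon> \<longrightarrow>
      (\<exists>t c. \<epsilon> \<notin> lvars t \<and> c > 0 \<and> I\<epsilon> = Le0 (t - lscale c (lvar \<epsilon>)) \<and>
             interpolant A B (Lt0 t)))"
proof -
  obtain c d where cd: "c \<le> 0" "0 \<le> d" "\<not> (c = 0 \<and> d = 0)"
    and root: "derives P (Le0 (lconst c - lscale d (lvar \<epsilon>)))"
    and leaves: "set_la_proof P \<subseteq> eps_set \<epsilon> A \<union> eps_set \<epsilon> B"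
    using assms(6) by (auto simp: eps_refutation_def)
  have split: "split_atom \<epsilon> A B (Le0 (lconst c - lscale d (lvar \<epsilon>))) I\<epsilon>"
    using split_atom_replay[OF root _ leaves] assms(7) by (simp add: proof_interpolant_def)
  then obtain u where u: "I\<epsilon> = Le0 u" by (cases I\<epsilon>) auto
  obtain s e where s: "u = s - lscale e (lvar \<epsilon>)" "eps_bound A s e"
    using split u by (auto simp: eps_consequence_def)
  obtain r f where r: "lconst c - lscale d (lvar \<epsilon>) - u = r - lscale f (lvar \<epsilon>)"
      "eps_bound B r f"
    using split u by (auto simp: eps_consequence_def)
  \<comment> \<open>Freshness of \<epsilon> enters here: as \<open>s\<close> and \<open>r\<close>
    are free of it, its coefficient on either side is exactly the negated weight, and comparing
    coefficients gives \<open>d = e + f\<close>.\<close>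
  have \<epsilon>s: "\<epsilon> \<notin> lvars s" and \<epsilon>r: "\<epsilon> \<notin> lvars r"
    using s(2) r(2) assms(3,4) by (auto simp: eps_bound_def vars_of_def)
  have coeff: "(if x = \<epsilon> then - d else 0) =
      Poly_Mapping.lookup (snd s) x + Poly_Mapping.lookup (snd r) x -
        (if x = \<epsilon> then e + f else 0)" for x
    using arg_cong[OF r(1), of "\<lambda>t. Poly_Mapping.lookup (snd t) x"]
    by (auto simp: s(1) lookup_minus lconst_def split: if_splits)
  have d: "d = e + f"
    using coeff[of \<epsilon>] \<epsilon>s \<epsilon>r by (simp add: in_lvars_iff)
  have sum: "s + r = lconst c"
  proof (rule lterm_eqI)
    show "fst (s + r) = fst (lconst c :: 'v lterm)"
      using arg_cong[OF r(1), of fst] by (simp add: s(1) lconst_def)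
    show "Poly_Mapping.lookup (snd (s + r)) x = Poly_Mapping.lookup (snd (lconst c)) x" for x
      using coeff[of x] d by (simp add: lookup_add lconst_def split: if_splits)
  qed
  have leval_sum: "leval \<sigma> s + leval \<sigma> r = c" for \<sigma>
    using arg_cong[OF sum, of "leval \<sigma>"] by simp
  have "lvars s \<subseteq> lvars r"
  proof
    fix x assume "x \<in> lvars s"
    moreover have "Poly_Mapping.lookup (snd (s + r)) x = 0"
      by (simp add: sum lconst_def)
    ultimately show "x \<in> lvars r"
      by (auto simp: in_lvars_iff lookup_add)
  qed
  then have vars: "lvars s \<subseteq> vars_of A \<inter> vars_of B"
    using s(2) r(2) by (auto simp: eps_bound_def)
  have e: "\<epsilon> \<in> atom_vars I\<epsilon> \<longleftrightarrow> 0 < e"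
    using \<epsilon>s s(2) by (auto simp: u s(1) eps_bound_def in_lvars_iff lookup_minus)
  have A: "0 \<le> leval \<sigma> s \<and> (0 < e \<longrightarrow> 0 < leval \<sigma> s)" if "\<forall>a\<in>A. sat_atom \<sigma> a" for \<sigma>
    using that s(2) by (auto simp: eps_bound_def)
  have B: "0 \<le> leval \<sigma> r \<and> (0 < f \<longrightarrow> 0 < leval \<sigma> r)" if "\<forall>a\<in>B. sat_atom \<sigma> a" for \<sigma>
    using that r(2) by (auto simp: eps_bound_def)
  have unsat: "unsat (A \<union> B)"
    using assms(2,4) by simp
  show ?thesis
  proof (intro conjI impI)
    assume "\<epsilon> \<notin> atom_vars I\<epsilon>"
    then have "e = 0"
      using e s(2) by (auto simp: eps_bound_def)
    have "u = s"
      by (rule lterm_eqI) (simp_all add: s(1) \<open>e = 0\<close> lookup_minus)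
    \<comment> \<open>Two nonnegative values sum to \<open>c \<le> 0\<close>, so both and
      \<open>c\<close> are 0. Then \<open>d = f\<close> must be positive, which would make the value
      of \<open>r\<close> positive.\<close>
    have "False" if "0 \<le> leval \<sigma> s" "\<forall>a\<in>B. sat_atom \<sigma> a" for \<sigma>
      using that(1) B[OF that(2)] leval_sum[of \<sigma>] cd d \<open>e = 0\<close> by linarith
    then have "unsat (insert (Le0 s) B)"
      by (auto simp: unsat_def)
    then show "interpolant A B I\<epsilon>"
      using A vars unsat by (auto simp: u \<open>u = s\<close> interpolant_def entails_def)
  next
    assume "\<epsilon> \<in> atom_vars I\<epsilon>"
    then have "0 < e" using e by simp
    \<comment> \<open>Strictness of \<open>s\<close> alone contradicts \<open>c \<le> 0\<close>,
      whether or not \<open>f\<close> is positive.\<close>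
    have "False" if "0 < leval \<sigma> s" "\<forall>a\<in>B. sat_atom \<sigma> a" for \<sigma>
      using that(1) B[OF that(2)] leval_sum[of \<sigma>] cd(1) by linarith
    then have "unsat (insert (Lt0 s) B)"
      by (auto simp: unsat_def)
    then have "interpolant A B (Lt0 s)"
      using A vars unsat \<open>0 < e\<close> by (auto simp: interpolant_def entails_def)
    \<comment> \<open>The witnesses are \<open>s\<close> and the weight \<open>e\<close>; the bound
      variable \<open>c\<close> is not the constant of the root.\<close>
    then show "\<exists>t c. \<epsilon> \<notin> lvars t \<and> c > 0 \<and> I\<epsilon> = Le0 (t - lscale c (lvar \<epsilon>)) \<and>
        interpolant A B (Lt0 t)"
      using \<epsilon>s \<open>0 < e\<close> u s(1) by blast
  qed
qed

end
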